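(* Let $\mathbb{F}$ be a field, $\mathbb{V}$ a finite-dimensional $\mathbb{F}$-vector space, and $T\in L(\mathbb{V})$. An operator $S\in Z_L(T)$ strongly commutes with $T$ if and only if $S\in\mathbb{F}[T]$.
   Context: $L(\mathbb{V})$ is the $\mathbb{F}$-algebra of all linear maps $\mathbb{V}\to\mathbb{V}$; $Z_L(T)$ is the subalgebra of operators commuting with $T$; $\mathbb{F}[T]$ is the $\mathbb{F}$-subalgebra generated by $T$. An operator $S\in L(\mathbb{V})$ strongly commutes with $T$ if $S$ commutes with $T$ and leaves invariant every $T$-invariant subspace of $\mathbb{V}$. *)

theory Defs
  imports Complex_Main
begin

text \<open>
  The vector space is given by a field type \<open>'a\<close>, a type \<open>'b\<close> of vectors and a scalar
  multiplication \<open>s\<close>, as in the locale \<^locale>\<open>vector_space\<close>.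
\<close>

definition lin_ops :: "('a::field \<Rightarrow> 'b::ab_group_add \<Rightarrow> 'b) \<Rightarrow> ('b \<Rightarrow> 'b) set" where
  "lin_ops s = {S. Vector_Spaces.linear s s S}"

definition commutant :: "('a::field \<Rightarrow> 'b::ab_group_add \<Rightarrow> 'b) \<Rightarrow> ('b \<Rightarrow> 'b) \<Rightarrow> ('b \<Rightarrow> 'b) set" where
  "commutant s T = {S \<in> lin_ops s. S \<circ> T = T \<circ> S}"

text \<open>Subalgebras are unital: they contain the identity operator.\<close>

definition subalgebra :: "('a::field \<Rightarrow> 'b::ab_group_add \<Rightarrow> 'b) \<Rightarrow> ('b \<Rightarrow> 'b) set \<Rightarrow> bool" where
  "subalgebra s \<A> \<longleftrightarrow>
     \<A> \<subseteq> lin_ops s \<and> id \<in> \<A> \<and>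
     (\<forall>A\<in>\<A>. \<forall>B\<in>\<A>. (\<lambda>v. A v + B v) \<in> \<A>) \<and>
     (\<forall>c. \<forall>A\<in>\<A>. (\<lambda>v. s c (A v)) \<in> \<A>) \<and>
     (\<forall>A\<in>\<A>. \<forall>B\<in>\<A>. A \<circ> B \<in> \<A>)"

definition generated_algebra ::
  "('a::field \<Rightarrow> 'b::ab_group_add \<Rightarrow> 'b) \<Rightarrow> ('b \<Rightarrow> 'b) \<Rightarrow> ('b \<Rightarrow> 'b) set" where
  "generated_algebra s T = subalgebra s hull {T}"

definition invariant_subspace ::
  "('a::field \<Rightarrow> 'b::ab_group_add \<Rightarrow> 'b) \<Rightarrow> ('b \<Rightarrow> 'b) \<Rightarrow> 'b set \<Rightarrow> bool" where
  "invariant_subspace s T W \<longleftrightarrow> module.subspace s W \<and> T ` W \<subseteq> W"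

definition strongly_commutes ::
  "('a::field \<Rightarrow> 'b::ab_group_add \<Rightarrow> 'b) \<Rightarrow> ('b \<Rightarrow> 'b) \<Rightarrow> ('b \<Rightarrow> 'b) \<Rightarrow> bool" where
  "strongly_commutes s S T \<longleftrightarrow>
     S \<in> commutant s T \<and> (\<forall>W. invariant_subspace s T W \<longrightarrow> S ` W \<subseteq> W)"

end

theory Submission
  imports Defs "HOL-Computational_Algebra.Polynomial"
begin

text \<open>
  Operators in \<open>F[T]\<close> are the polynomials in \<open>T\<close>, so they preserve every \<open>T\<close>-invariant
  subspace. The content is the converse, and the idea is to regard \<open>V\<close> as a module
  over the principal ideal domain \<open>F[x]\<close>, with \<open>x\<close> acting as \<open>T\<close>. The order of a vector is a
  generator of its annihilator, an ideal of \<open>F[x]\<close> that is nonzero by finite dimension.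

  There is a vector \<open>u\<close> whose order \<open>f\<close> kills all of \<open>V\<close> (\<open>maximal_order\<close>): take \<open>f\<close> of
  maximal degree; if the order \<open>g\<close> of some \<open>v\<close> did not divide \<open>f\<close>, then \<open>f = a f'\<close> and
  \<open>g = b g'\<close> with \<open>b\<close> coprime to \<open>f'\<close> and of larger degree than \<open>a\<close>, and the vector
  \<open>a(T) u + g'(T) v\<close> would have the order \<open>f' b\<close>, of degree larger than that of \<open>f\<close>.

  Let \<open>S\<close> commute strongly with \<open>T\<close>. It preserves the cyclic subspace \<open>F[T] u\<close>, so
  \<open>S u = p(T) u\<close> for some \<open>p\<close>; the claim is that \<open>R = S - p(T)\<close>, which also commutes strongly
  with \<open>T\<close> and has \<open>R u = 0\<close>, vanishes (\<open>strongly_commuting_vanishes\<close>). Because \<open>f\<close> kills \<open>V\<close>,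
  any vector can be written as \<open>h(T) u + w\<close>, where \<open>F[T] w\<close> meets \<open>F[T] u\<close> trivially
  (\<open>independent_representative\<close>). As \<open>R\<close> kills \<open>h(T) u\<close>, only \<open>R w = 0\<close> is at stake.
  Invariance of \<open>F[T] w\<close> and \<open>F[T] (u + w)\<close> gives \<open>R w = q(T) w\<close> and
  \<open>R w = R (u + w) = r(T) u + r(T) w\<close>; by independence \<open>r(T) u = 0\<close>, hence \<open>f\<close> divides \<open>r\<close>
  and \<open>r(T) = 0\<close>, so that \<open>R w = 0\<close>.
\<close>

section \<open>Divisibility of polynomials over a field\<close>

lemma principal_ideal_poly:
  fixes I :: "'a::field poly set"
  assumes "0 \<in> I"
    and add: "\<And>p q. p \<in> I \<Longrightarrow> q \<in> I \<Longrightarrow> p + q \<in> I"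
    and mult: "\<And>p q. q \<in> I \<Longrightarrow> p * q \<in> I"
  shows "\<exists>g. \<forall>p. p \<in> I \<longleftrightarrow> g dvd p"
proof (cases "I \<subseteq> {0}")
  case True
  then have "p \<in> I \<longleftrightarrow> 0 dvd p" for p
    using assms(1) by auto
  then show ?thesis by blast
next
  case False
  then obtain g where g: "g \<in> I" "g \<noteq> 0"
    and min: "\<And>p. p \<in> I \<Longrightarrow> p \<noteq> 0 \<Longrightarrow> degree g \<le> degree p"
    using ex_has_least_nat[of "\<lambda>p. p \<in> I \<and> p \<noteq> 0" _ degree] by blast
  have "g dvd p" if "p \<in> I" for p
  proof -
    have "p mod g = p + (- (p div g)) * g"
      by (simp add: minus_div_mult_eq_mod[symmetric])
    then have "p mod g \<in> I"
      using add[OF that mult[OF g(1)]] by metis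
    then have "p mod g = 0"
      using min[of "p mod g"] degree_mod_less[OF g(2), of p] by fastforce
    then show ?thesis by (rule mod_0_imp_dvd)
  qed
  moreover have "p \<in> I" if "g dvd p" for p
    using that mult[OF g(1)] by (metis dvdE mult.commute)
  ultimately show ?thesis by blast
qed

text \<open>
  For polynomials over a field this is coprimality. The explicit identity is what the rules
  below compute with: multiply it by the polynomial in question.
\<close>

definition bezout_coprime :: "'a::comm_ring_1 \<Rightarrow> 'a \<Rightarrow> bool" where
  "bezout_coprime a b \<longleftrightarrow> (\<exists>x y. x * a + y * b = 1)"

lemma bezout_coprime_sym: "bezout_coprime a b \<Longrightarrow> bezout_coprime b a"
  unfolding bezout_coprime_def by (metis add.commute)

lemma bezout_coprime_dvd_mult:
  assumes "bezout_coprime a b" "b dvd a * c"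
  shows "b dvd c"
proof -
  obtain x y where "x * a + y * b = 1"
    using assms(1) unfolding bezout_coprime_def by blast
  then have "c = (x * a + y * b) * c" by simp
  also have "\<dots> = x * (a * c) + b * (y * c)" by (simp add: algebra_simps)
  finally show ?thesis
    using assms(2) by (metis dvd_add dvd_mult dvd_triv_left)
qed

lemma bezout_coprime_mult_dvd:
  assumes "bezout_coprime a b" "a dvd c" "b dvd c"
  shows "a * b dvd c"
proof -
  obtain k where k: "c = a * k" using assms(2) by blast
  then have "b dvd k" using bezout_coprime_dvd_mult assms(1,3) by blast
  then show ?thesis using k by (simp add: mult_dvd_mono)
qed

lemma bezout_coprime_power:
  assumes "bezout_coprime a b"
  shows "bezout_coprime (a ^ n) b"
proof (induction n)
  case 0
  have "1 * a ^ 0 + 0 * b = 1" by simp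
  then show ?case unfolding bezout_coprime_def by blast
next
  case (Suc n)
  obtain x y where xy: "x * a + y * b = 1"
    using assms unfolding bezout_coprime_def by blast
  obtain z w where zw: "z * a ^ n + w * b = 1"
    using Suc.IH unfolding bezout_coprime_def by blast
  \<comment> \<open>The product of the two identities, with all terms but \<open>x a z a\<^sup>n\<close> collected at \<open>b\<close>.\<close>
  have "(x * z) * a ^ Suc n + (y * (z * a ^ n + w * b) + x * a * w) * b
      = (x * a + y * b) * (z * a ^ n + w * b)"
    by (simp add: algebra_simps)
  then have "(x * z) * a ^ Suc n + (y * (z * a ^ n + w * b) + x * a * w) * b = 1"
    using xy zw by simp
  then show ?case unfolding bezout_coprime_def by blast
qed

text \<open>
  A generator of the ideal \<open>(p, f)\<close> divides \<open>p\<close>, so it is a unit or an associate of \<open>p\<close>; in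
  the second case \<open>p\<close> would divide \<open>f\<close>.
\<close>

lemma irreducible_bezout_coprime:
  fixes p f :: "'a::field poly"
  assumes "irreducible p" "\<not> p dvd f"
  shows "bezout_coprime p f"
proof -
  define I where "I = {q. \<exists>x y. q = x * p + y * f}"
  have "0 \<in> I"
    unfolding I_def by (auto intro: exI[of _ 0])
  moreover have "q + r \<in> I" if qr: "q \<in> I" "r \<in> I" for q r
  proof -
    obtain x y z w where "q = x * p + y * f" "r = z * p + w * f"
      using qr unfolding I_def by blast
    then have "q + r = (x + z) * p + (y + w) * f" by (simp add: algebra_simps)
    then show ?thesis unfolding I_def by blast
  qed
  moreover have "r * q \<in> I" if q: "q \<in> I" for q r
  proof -
    obtain x y where "q = x * p + y * f"
      using q unfolding I_def by blast
    then have "r * q = (r * x) * p + (r * y) * f" by (simp add: algebra_simps)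
    then show ?thesis unfolding I_def by blast
  qed
  ultimately have "\<exists>d. \<forall>q. q \<in> I \<longleftrightarrow> d dvd q"
    by (rule principal_ideal_poly)
  then obtain d where d: "\<And>q. q \<in> I \<longleftrightarrow> d dvd q" by blast
  have "p = 1 * p + 0 * f" "f = 0 * p + 1 * f" by simp_all
  then have "p \<in> I" "f \<in> I" unfolding I_def by blast+
  then have "d dvd p" "d dvd f" using d by auto
  obtain k where k: "p = d * k" using \<open>d dvd p\<close> by blast
  have "\<not> is_unit k"
  proof
    assume "is_unit k"
    then have "p dvd d" using k by (simp add: mult_unit_dvd_iff)
    then show False using assms(2) \<open>d dvd f\<close> dvd_trans by blast
  qed
  then have "d dvd 1"
    using irreducibleD[OF assms(1) k] by blast
  then have "1 \<in> I" using d by blast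
  then show ?thesis unfolding I_def bezout_coprime_def by auto
qed

lemma nonconstant_poly_has_irreducible_factor:
  fixes g :: "'a::field poly"
  assumes "degree g > 0"
  obtains p where "irreducible p" "degree p > 0" "p dvd g"
proof -
  have "\<exists>p. (p dvd g \<and> degree p > 0) \<and>
      (\<forall>q. q dvd g \<and> degree q > 0 \<longrightarrow> degree p \<le> degree q)"
    by (rule ex_has_least_nat[of _ g]) (use assms in simp)
  then obtain p where p: "p dvd g" "degree p > 0"
    and min: "\<And>q. q dvd g \<Longrightarrow> degree q > 0 \<Longrightarrow> degree p \<le> degree q"
    by blast
  have "p \<noteq> 0" using p(2) by auto
  have "irreducible p"
  proof (rule irreducibleI)
    show "p \<noteq> 0" by fact
    show "\<not> is_unit p" using p(2) by (auto simp: is_unit_iff_degree[OF \<open>p \<noteq> 0\<close>])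
    fix a b assume ab: "p = a * b"
    have nz: "a \<noteq> 0" "b \<noteq> 0" using ab \<open>p \<noteq> 0\<close> by auto
    have deg: "degree p = degree a + degree b"
      using ab nz by (simp add: degree_mult_eq)
    have "a dvd g" "b dvd g" using ab p(1) dvd_mult_left dvd_mult_right by blast+
    then have "degree a = 0 \<or> degree b = 0" using min[of a] min[of b] deg by linarith
    then show "is_unit a \<or> is_unit b" using nz by (simp add: is_unit_iff_degree)
  qed
  then show ?thesis using p that by blast
qed

lemma split_off_power:
  fixes f p :: "'a::field poly"
  assumes "f \<noteq> 0" "degree p > 0"
  obtains n f' where "f = p ^ n * f'" "\<not> p dvd f'"
  using assms(1)
proof (induction "degree f" arbitrary: f thesis rule: less_induct)
  case less
  show ?case
  proof (cases "p dvd f")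
    case False
    then show ?thesis using less.prems(1)[of 0 f] by simp
  next
    case True
    then obtain k where k: "f = p * k" by blast
    then have "k \<noteq> 0" "p \<noteq> 0" using less.prems(2) by auto
    then have "degree k < degree f" using k assms(2) by (simp add: degree_mult_eq)
    then obtain n f' where "k = p ^ n * f'" "\<not> p dvd f'"
      using less.hyps \<open>k \<noteq> 0\<close> by blast
    then show ?thesis using less.prems(1)[of "Suc n" f'] k by (simp add: mult.assoc)
  qed
qed

text \<open>
  Some prime \<open>p\<close> occurs in \<open>g\<close> with a larger exponent than in \<open>f\<close>; \<open>a\<close> and \<open>b\<close> are the full
  powers of \<open>p\<close> in \<open>f\<close> and \<open>g\<close>. The induction looks for \<open>p\<close>: an irreducible factor of \<open>g\<close> that
  does not qualify is cancelled from \<open>g\<close>, and what remains still does not divide \<open>f\<close>.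
\<close>

lemma not_dvd_coprime_factors:
  fixes f g :: "'a::field poly"
  assumes "f \<noteq> 0" "g \<noteq> 0" "\<not> g dvd f"
  obtains a f' b g' where "f = a * f'" "g = b * g'" "bezout_coprime f' b" "degree a < degree b"
  using assms(2,3)
proof (induction "degree g" arbitrary: g thesis rule: less_induct)
  case less
  have "degree g > 0"
    using less.prems(2,3) is_unit_iff_degree[of g] unit_imp_dvd[of g f] by blast
  then obtain p where p: "irreducible p" "degree p > 0" "p dvd g"
    by (rule nonconstant_poly_has_irreducible_factor)
  obtain j f' where f': "f = p ^ j * f'" "\<not> p dvd f'"
    using split_off_power assms(1) p(2) by blast
  obtain e g' where g': "g = p ^ e * g'" "\<not> p dvd g'"
    using split_off_power less.prems(2) p(2) by blast
  have coprime_power: "bezout_coprime (p ^ n) h" if "\<not> p dvd h" for n h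
    using bezout_coprime_power irreducible_bezout_coprime p(1) that by blast
  have "p \<noteq> 0" "g' \<noteq> 0" using p(2) g'(1) less.prems(2) by auto
  have degree_p_power: "degree (p ^ n) = n * degree p" for n
    using \<open>p \<noteq> 0\<close> by (simp add: degree_power_eq)
  show ?case
  proof (cases "j < e")
    case True
    then have "degree (p ^ j) < degree (p ^ e)" using p(2) degree_p_power by simp
    then show ?thesis
      using less.prems(1) f'(1) g'(1) bezout_coprime_sym[OF coprime_power[OF f'(2)]] by blast
  next
    case False
    have "\<not> g' dvd f"
    proof
      assume "g' dvd f"
      then have "g' dvd f'"
        using bezout_coprime_dvd_mult[OF coprime_power[OF g'(2)]] f'(1) by blast
      moreover have "p ^ e dvd p ^ j" using False by (simp add: le_imp_power_dvd)
      ultimately show False using less.prems(3) f'(1) g'(1) by (simp add: mult_dvd_mono)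
    qed
    moreover have "degree g' < degree g"
    proof -
      have "e \<noteq> 0" using g' p(3) by (cases e) auto
      then show ?thesis
        using g'(1) \<open>p \<noteq> 0\<close> \<open>g' \<noteq> 0\<close> p(2) degree_p_power by (simp add: degree_mult_eq)
    qed
    ultimately obtain a f'' b g'' where
      "f = a * f''" "g' = b * g''" "bezout_coprime f'' b" "degree a < degree b"
      using less.hyps \<open>g' \<noteq> 0\<close> by blast
    then show ?thesis
      using less.prems(1)[of a f'' b "p ^ e * g''"] g'(1) by (simp add: algebra_simps)
  qed
qed

section \<open>Polynomials in an operator\<close>

locale operator = vector_space scale
  for scale :: "'a::field \<Rightarrow> 'b::ab_group_add \<Rightarrow> 'b" (infixr \<open>*s\<close> 75) +
  fixes T :: "'b \<Rightarrow> 'b"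
  assumes T_linear: "Vector_Spaces.linear scale scale T"
begin

lemma T_add: "T (v + w) = T v + T w"
  and T_scale: "T (c *s v) = c *s T v"
  using T_linear by (auto simp: Vector_Spaces.linear_iff)

lemma T_zero [simp]: "T 0 = 0"
  using T_add[of 0 0] by simp

text \<open>The vector \<open>p(T) v\<close>, by the Horner scheme.\<close>

definition act :: "'a poly \<Rightarrow> 'b \<Rightarrow> 'b" where
  "act p = fold_coeffs (\<lambda>a A v. a *s v + T (A v)) p (\<lambda>v. 0)"

lemma act_0 [simp]: "act 0 v = 0"
  by (simp add: act_def)

lemma act_pCons [simp]: "act (pCons a p) v = a *s v + T (act p v)"
  by (cases "p = 0 \<and> a = 0") (auto simp: act_def)

lemma act_1 [simp]: "act 1 v = v"
  by (simp add: one_pCons)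

lemma act_add: "act (p + q) v = act p v + act q v"
  by (induction p q rule: poly_induct2) (simp_all add: T_add scale_left_distrib)

lemma act_smult: "act (smult c p) v = c *s act p v"
  by (induction p) (simp_all add: T_scale scale_right_distrib)

lemma act_diff: "act (p - q) v = act p v - act q v"
  using act_add[of "p - q" q v] by simp

lemma act_mult: "act (p * q) v = act p (act q v)"
  by (induction p) (simp_all add: act_add act_smult)

lemma act_commute: "act p (act q v) = act q (act p v)"
  by (metis act_mult mult.commute)

lemma act_vector_add: "act p (v + w) = act p v + act p w"
  by (induction p) (simp_all add: T_add scale_right_distrib)

lemma act_vector_scale: "act p (c *s v) = c *s act p v"
  by (induction p) (simp_all add: T_scale scale_right_distrib scale_left_commute)

lemma act_vector_0 [simp]: "act p 0 = 0"
  using act_vector_scale[of p 0 0] by simp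

lemma act_vector_diff: "act p (v - w) = act p v - act p w"
  using act_vector_add[of p "v - w" w] by simp

lemma act_monom: "act (monom c n) v = c *s (T ^^ n) v"
  by (induction n) (simp_all add: monom_0 monom_Suc T_scale)

lemma act_sum: "act (\<Sum>i\<in>A. p i) v = (\<Sum>i\<in>A. act (p i) v)"
  by (induction A rule: infinite_finite_induct) (simp_all add: act_add)

lemma act_in_lin_ops: "act p \<in> lin_ops scale"
  using vector_space_axioms
  by (simp add: lin_ops_def Vector_Spaces.linear_iff act_vector_add act_vector_scale)

lemma act_in_invariant_subspace:
  assumes "invariant_subspace scale T W" "v \<in> W"
  shows "act p v \<in> W"
  using assms
  by (induction p)
    (auto simp: invariant_subspace_def intro!: subspace_add subspace_scale subspace_0)

text \<open>
  One inclusion holds because the polynomials in \<open>T\<close> form a subalgebra containing \<open>T\<close>, the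
  other because the Horner scheme uses only the operations of a subalgebra.
\<close>

lemma generated_algebra_eq: "generated_algebra scale T = range act"
  unfolding generated_algebra_def
proof (rule hull_unique)
  have "T = act [:0, 1:]" by (simp add: fun_eq_iff)
  then show "{T} \<subseteq> range act" by blast
  have "id = act 1" by (simp add: fun_eq_iff)
  moreover have "(\<lambda>v. act p v + act q v) = act (p + q)" for p q
    by (simp add: fun_eq_iff act_add)
  moreover have "(\<lambda>v. c *s act p v) = act (smult c p)" for c p
    by (simp add: fun_eq_iff act_smult)
  moreover have "act p \<circ> act q = act (p * q)" for p q
    by (simp add: fun_eq_iff act_mult)
  ultimately show "subalgebra scale (range act)"
    unfolding subalgebra_def using act_in_lin_ops by auto
next
  fix \<A> assume T: "{T} \<subseteq> \<A>" and sub: "subalgebra scale \<A>"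
  have id: "id \<in> \<A>"
    and add: "\<And>A B. A \<in> \<A> \<Longrightarrow> B \<in> \<A> \<Longrightarrow> (\<lambda>v. A v + B v) \<in> \<A>"
    and scale: "\<And>c A. A \<in> \<A> \<Longrightarrow> (\<lambda>v. c *s A v) \<in> \<A>"
    and comp: "\<And>A B. A \<in> \<A> \<Longrightarrow> B \<in> \<A> \<Longrightarrow> A \<circ> B \<in> \<A>"
    using sub unfolding subalgebra_def by blast+
  have "act p \<in> \<A>" for p
  proof (induction p)
    case 0
    have "act 0 = (\<lambda>v. 0 *s id v)" by (simp add: fun_eq_iff)
    then show ?case using scale[OF id] by metis
  next
    case (pCons a p)
    have "act (pCons a p) = (\<lambda>v. a *s id v + (T \<circ> act p) v)"
      by (simp add: fun_eq_iff)
    then show ?case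
      using add[OF scale[OF id] comp[OF _ pCons.IH]] T by auto
  qed
  then show "range act \<subseteq> \<A>" by blast
qed

lemma cyclic_subspace_invariant: "invariant_subspace scale T (range (\<lambda>p. act p v))"
proof -
  have "0 \<in> range (\<lambda>p. act p v)"
    by (rule range_eqI[of _ _ 0]) simp
  moreover have "act p v + act q v = act (p + q) v" for p q
    by (simp add: act_add)
  moreover have "c *s act p v = act (smult c p) v" for c p
    by (simp add: act_smult)
  ultimately have "subspace (range (\<lambda>p. act p v))"
    unfolding subspace_def by auto
  moreover have "T (act p v) \<in> range (\<lambda>p. act p v)" for p
    by (rule range_eqI[of _ _ "pCons 0 p"]) simp
  ultimately show ?thesis unfolding invariant_subspace_def by auto
qed

text \<open>
  The polynomial depends on \<open>v\<close> here; a single one for all vectors is what remains to be found.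
\<close>

lemma strongly_commutes_imp_act:
  assumes "strongly_commutes scale S T"
  obtains p where "S v = act p v"
proof -
  have "S ` range (\<lambda>p. act p v) \<subseteq> range (\<lambda>p. act p v)"
    using assms cyclic_subspace_invariant unfolding strongly_commutes_def by blast
  moreover have "v \<in> range (\<lambda>p. act p v)"
    by (rule range_eqI[of _ _ 1]) simp
  ultimately show ?thesis using that by blast
qed

lemma commutant_act:
  assumes "S \<in> commutant scale T"
  shows "S (act p v) = act p (S v)"
proof -
  have "Vector_Spaces.linear scale scale S" and ST: "S \<circ> T = T \<circ> S"
    using assms by (auto simp: commutant_def lin_ops_def)
  then have "S (v + w) = S v + S w" "S (c *s v) = c *s S v" "S 0 = 0" for c v w
    by (auto simp: Vector_Spaces.linear_iff) (metis scale_zero_left)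
  then show ?thesis
    using fun_cong[OF ST] by (induction p) simp_all
qed

section \<open>Orders of vectors\<close>

text \<open>
  A relation, because a generator of the annihilator is unique only up to a unit; \<open>f = 0\<close> means
  that \<open>v\<close> has no nonzero annihilator.
\<close>

definition is_order :: "'a poly \<Rightarrow> 'b \<Rightarrow> bool" where
  "is_order f v \<longleftrightarrow> (\<forall>p. act p v = 0 \<longleftrightarrow> f dvd p)"

lemma is_orderD: "is_order f v \<Longrightarrow> act p v = 0 \<longleftrightarrow> f dvd p"
  by (simp add: is_order_def)

lemma order_exists: obtains f where "is_order f v"
proof -
  have "\<exists>f. \<forall>p. p \<in> {p. act p v = 0} \<longleftrightarrow> f dvd p"
    by (rule principal_ideal_poly) (simp_all add: act_add act_mult)
  then show thesis using that unfolding is_order_def by blast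
qed

lemma is_order_act:
  assumes "is_order (a * f) v" "a \<noteq> 0"
  shows "is_order f (act a v)"
  unfolding is_order_def
proof
  fix p
  have "act p (act a v) = 0 \<longleftrightarrow> a * f dvd a * p"
    using is_orderD[OF assms(1), of "a * p"] by (simp add: act_mult act_commute)
  then show "act p (act a v) = 0 \<longleftrightarrow> f dvd p" using assms(2) by simp
qed

text \<open>If \<open>p\<close> kills the sum, then \<open>p f\<close> kills \<open>v\<close> and \<open>p g\<close> kills \<open>u\<close>.\<close>

lemma is_order_add:
  assumes u: "is_order f u" and v: "is_order g v" and fg: "bezout_coprime f g"
  shows "is_order (f * g) (u + v)"
  unfolding is_order_def
proof (intro allI iffI)
  fix p assume p: "act p (u + v) = 0"
  have kill: "act f u = 0" "act g v = 0"
    using is_orderD[OF u] is_orderD[OF v] by auto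
  have "act (f * p) (u + v) = act (f * p) v"
    using kill(1) by (simp add: act_vector_add act_mult act_commute[of f p])
  then have "act (f * p) v = 0" using p by (simp add: act_mult)
  then have "g dvd p"
    using is_orderD[OF v] bezout_coprime_dvd_mult[OF fg] by blast
  have "act (g * p) (u + v) = act (g * p) u"
    using kill(2) by (simp add: act_vector_add act_mult act_commute[of g p])
  then have "act (g * p) u = 0" using p by (simp add: act_mult)
  then have "f dvd p"
    using is_orderD[OF u] bezout_coprime_dvd_mult[OF bezout_coprime_sym[OF fg]] by blast
  then show "f * g dvd p"
    using \<open>g dvd p\<close> bezout_coprime_mult_dvd[OF fg] by blast
next
  fix p assume "f * g dvd p"
  then have "f dvd p" "g dvd p" using dvd_mult_left dvd_mult_right by blast+
  then have "act p u = 0" "act p v = 0" using is_orderD[OF u] is_orderD[OF v] by blast+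
  then show "act p (u + v) = 0" by (simp add: act_vector_add)
qed

text \<open>
  Let \<open>g\<close> generate the conductor of \<open>v\<close> into \<open>F[T] u\<close>, so that \<open>g(T) v = k(T) u\<close>, and write
  \<open>f = g d\<close>. Then \<open>(d k)(T) u = f(T) v = 0\<close>, so \<open>g d\<close> divides \<open>d k\<close> and \<open>k = g h\<close>. This \<open>h\<close>
  works, since \<open>g\<close> kills \<open>v - h(T) u\<close>, and a polynomial that moves this vector into
  \<open>F[T] u\<close> is a multiple of \<open>g\<close>.
\<close>

lemma independent_representative:
  assumes u: "is_order f u" and "f \<noteq> 0" and f: "\<And>v. act f v = 0"
  obtains h where "\<And>p q. act p (v - act h u) = act q u \<Longrightarrow> act p (v - act h u) = 0"
proof -
  define I where "I = {p. \<exists>q. act p v = act q u}"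
  have "0 \<in> I" unfolding I_def by (auto intro!: exI[of _ 0])
  moreover have "p + p' \<in> I" if "p \<in> I" "p' \<in> I" for p p'
    using that unfolding I_def by (auto simp: act_add[symmetric]) (metis act_add)
  moreover have "p' * p \<in> I" if "p \<in> I" for p p'
    using that unfolding I_def by (auto simp: act_mult) (metis act_mult)
  ultimately have "\<exists>g. \<forall>p. p \<in> I \<longleftrightarrow> g dvd p"
    by (rule principal_ideal_poly)
  then obtain g where g: "\<And>p. p \<in> I \<longleftrightarrow> g dvd p" by blast
  have "f \<in> I" using f[of v] unfolding I_def by (auto intro!: exI[of _ 0])
  then have "g dvd f" using g by blast
  then obtain d where d: "f = g * d" by blast
  have "g \<in> I" using g[of g] by simp
  then obtain k where k: "act g v = act k u" unfolding I_def by blast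
  have "act (d * k) u = act d (act g v)" by (simp add: act_mult k)
  also have "\<dots> = act f v" by (simp add: d act_mult act_commute)
  finally have "act (d * k) u = 0" using f by simp
  then have "d * g dvd d * k" using is_orderD[OF u] d by (simp add: mult.commute)
  then obtain h where h: "k = g * h" using d \<open>f \<noteq> 0\<close> by auto
  define w where "w = v - act h u"
  have "act g w = 0" by (simp add: w_def act_vector_diff k h act_mult)
  have "act p w = 0" if "act p w = act q u" for p q
  proof -
    have "act p v = act (q + p * h) u"
      using that by (simp add: w_def act_vector_diff act_add act_mult diff_eq_eq)
    then have "p \<in> I" unfolding I_def by blast
    then have "g dvd p" using g by blast
    then obtain r where "p = g * r" by blast
    then show ?thesis using \<open>act g w = 0\<close> by (simp add: act_mult act_commute[of g r])
  qed
  then show ?thesis using that unfolding w_def by blast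
qed

text \<open>
  On \<open>w\<close>, taken from the previous lemma, \<open>R\<close> acts as some \<open>q(T)\<close>, and on \<open>u + w\<close> as some
  \<open>r(T)\<close>. Since \<open>R u = 0\<close>, the vector \<open>r(T) u = (q - r)(T) w\<close> lies in both cyclic subspaces
  and is zero; the order of \<open>u\<close> then forces \<open>r(T) = 0\<close>.
\<close>

lemma strongly_commuting_vanishes:
  assumes R: "strongly_commutes scale R T" and "R u = 0"
    and u: "is_order f u" "f \<noteq> 0" and f: "\<And>v. act f v = 0"
  shows "R v = 0"
proof -
  have RT: "R \<in> commutant scale T" using R by (simp add: strongly_commutes_def)
  then have R_add: "R (x + y) = R x + R y" for x y
    by (simp add: commutant_def lin_ops_def Vector_Spaces.linear_iff)
  have R_cyclic: "R (act p u) = 0" for p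
    using commutant_act[OF RT] \<open>R u = 0\<close> by simp
  obtain h where h: "\<And>p q. act p (v - act h u) = act q u \<Longrightarrow> act p (v - act h u) = 0"
    using independent_representative[OF u f, of v] by blast
  define w where "w = v - act h u"
  obtain q where q: "R w = act q w" using strongly_commutes_imp_act[OF R] by blast
  obtain r where r: "R (u + w) = act r (u + w)" using strongly_commutes_imp_act[OF R] by blast
  have "act q w = act r u + act r w"
    using q r \<open>R u = 0\<close> by (simp add: R_add act_vector_add)
  then have qr: "act (q - r) w = act r u" by (simp add: act_diff)
  then have "act r u = 0" using h[of "q - r" r] by (simp add: w_def)
  then have "f dvd r" using is_orderD[OF u(1)] by blast
  then have "act r w = 0" using f by (metis act_mult act_commute dvdE act_vector_0)
  then have "R w = 0" using q qr \<open>act r u = 0\<close> by (simp add: act_diff)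
  moreover have "R v = R w + R (act h u)" by (simp add: w_def R_add[symmetric])
  ultimately show ?thesis using R_cyclic by simp
qed

lemma strongly_commutes_diff_act:
  assumes "strongly_commutes scale S T"
  shows "strongly_commutes scale (\<lambda>v. S v - act p v) T"
proof -
  have S: "S \<in> commutant scale T"
    and inv: "\<And>W. invariant_subspace scale T W \<Longrightarrow> S ` W \<subseteq> W"
    using assms by (auto simp: strongly_commutes_def)
  have "T (x - y) = T x - T y" for x y
    using T_add[of "x - y" y] by simp
  moreover have "S (T v) = T (S v)" for v
    using S by (auto simp: commutant_def fun_eq_iff)
  moreover have "act p (T v) = T (act p v)" for v
    using act_commute[of p "[:0, 1:]" v] by simp
  ultimately have "(\<lambda>v. S v - act p v) \<in> commutant scale T"
    using S vector_space_axioms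
    by (auto simp: commutant_def lin_ops_def Vector_Spaces.linear_iff fun_eq_iff
        act_vector_add act_vector_scale scale_right_diff_distrib)
  moreover have "S v - act p v \<in> W" if "invariant_subspace scale T W" "v \<in> W" for v W
    using that inv[OF that(1)] act_in_invariant_subspace[OF that]
    by (auto simp: invariant_subspace_def intro!: subspace_diff)
  ultimately show ?thesis by (auto simp: strongly_commutes_def)
qed

end

section \<open>Orders in finite dimension\<close>

locale finite_dimensional_operator = finite_dimensional_vector_space scale Basis + operator scale T
  for scale :: "'a::field \<Rightarrow> 'b::ab_group_add \<Rightarrow> 'b" (infixr \<open>*s\<close> 75) and Basis T
begin

text \<open>
  The \<open>dimension + 1\<close> vectors \<open>T\<^sup>i v\<close> are linearly dependent. If two of them coincide, they have
  to be treated separately, because dependence is a notion for sets.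
\<close>

lemma annihilator_exists:
  obtains p where "p \<noteq> 0" "act p v = 0" "degree p \<le> dimension"
proof (cases "inj_on (\<lambda>i. (T ^^ i) v) {..dimension}")
  case False
  then obtain i j where ij: "i \<le> dimension" "j \<le> dimension" "i \<noteq> j" "(T ^^ i) v = (T ^^ j) v"
    by (auto simp: inj_on_def)
  let ?p = "monom 1 i - monom 1 j :: 'a poly"
  have "coeff ?p i = 1" using ij(3) by simp
  then have "?p \<noteq> 0" by (metis coeff_0 zero_neq_one)
  moreover have "act ?p v = 0" using ij(4) by (simp add: act_diff act_monom)
  moreover have "degree ?p \<le> dimension"
    using ij(1,2) by (intro degree_diff_le) (simp_all add: degree_monom_eq)
  ultimately show ?thesis by (rule that)
next
  case True
  let ?P = "(\<lambda>i. (T ^^ i) v) ` {..dimension}"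
  have "card ?P = Suc dimension" using True by (simp add: card_image)
  then have "dependent ?P"
    using independent_bound_general[of ?P] dim_subset_UNIV[of ?P] by fastforce
  then obtain c x where c: "x \<in> ?P" "c x \<noteq> 0" "(\<Sum>x\<in>?P. c x *s x) = 0"
    using dependent_finite[of ?P] by auto
  let ?p = "\<Sum>i\<le>dimension. monom (c ((T ^^ i) v)) i"
  obtain j where j: "j \<le> dimension" "x = (T ^^ j) v" using c(1) by auto
  have "coeff ?p j = c x" using j by (simp add: coeff_sum)
  then have "?p \<noteq> 0" using c(2) by (metis coeff_0)
  moreover have "act ?p v = 0"
    using c(3) True by (simp add: act_sum act_monom sum.reindex)
  moreover have "degree ?p \<le> dimension"
    by (intro degree_sum_le) (auto intro: order_trans[OF degree_monom_le])
  ultimately show ?thesis by (rule that)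
qed

lemma order_nonzero_degree_le:
  assumes "is_order f v"
  shows "f \<noteq> 0" "degree f \<le> dimension"
proof -
  obtain p where p: "p \<noteq> 0" "act p v = 0" "degree p \<le> dimension"
    by (rule annihilator_exists)
  then have "f dvd p" using is_orderD[OF assms] by blast
  then show "f \<noteq> 0" "degree f \<le> dimension"
    using p dvd_imp_degree_le[of f p] by auto
qed

text \<open>
  Degrees of orders are bounded by the dimension, so one of maximal degree exists. It is
  divisible by every order \<open>g\<close>: otherwise trading its factor \<open>a\<close> for the factor \<open>b\<close> of \<open>g\<close>,
  of larger degree, would give an order of larger degree.
\<close>

lemma maximal_order: "\<exists>u f. is_order f u \<and> (\<forall>v. act f v = 0)"
proof -
  obtain f0 where f0: "is_order f0 0" by (rule order_exists)
  define is_deg where "is_deg = (\<lambda>n. \<exists>f u. is_order f u \<and> degree f = n)"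
  have "is_deg (degree f0)" using f0 unfolding is_deg_def by blast
  moreover have "n \<le> dimension" if "is_deg n" for n
    using that order_nonzero_degree_le(2) unfolding is_deg_def by blast
  ultimately obtain f u where u: "is_order f u" and "degree f = (GREATEST n. is_deg n)"
    using GreatestI_nat[of is_deg _ dimension] unfolding is_deg_def by blast
  then have max: "degree g \<le> degree f" if "is_order g v" for g v
    using that Greatest_le_nat[of is_deg "degree g" dimension]
      \<open>\<And>n. is_deg n \<Longrightarrow> n \<le> dimension\<close> unfolding is_deg_def by auto
  have "act f v = 0" for v
  proof -
    obtain g where v: "is_order g v" by (rule order_exists)
    have nz: "f \<noteq> 0" "g \<noteq> 0" using u v order_nonzero_degree_le(1) by blast+
    have "g dvd f"
    proof (rule ccontr)
      assume "\<not> g dvd f"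
      then obtain a f' b g' where fact: "f = a * f'" "g = b * g'"
        and coprime: "bezout_coprime f' b" and deg: "degree a < degree b"
        using not_dvd_coprime_factors[OF nz] by blast
      have nz': "a \<noteq> 0" "f' \<noteq> 0" "b \<noteq> 0" "g' \<noteq> 0" using fact nz by auto
      have "is_order f' (act a u)"
        using is_order_act u fact(1) nz'(1) by blast
      moreover have "is_order b (act g' v)"
        using is_order_act[of g' b v] v fact(2) nz'(4) by (simp add: mult.commute)
      ultimately have "degree (f' * b) \<le> degree f"
        using is_order_add[OF _ _ coprime] max by blast
      then show False using deg nz' fact(1) by (simp add: degree_mult_eq)
    qed
    then show ?thesis using is_orderD[OF v] by blast
  qed
  then show ?thesis using u by blast
qed

lemma strongly_commutes_imp_polynomial:
  assumes S: "strongly_commutes scale S T"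
  obtains p where "S = act p"
proof -
  obtain u f where u: "is_order f u" and f: "\<And>v. act f v = 0"
    using maximal_order by blast
  obtain p where p: "S u = act p u" using strongly_commutes_imp_act[OF S] by blast
  have "S v - act p v = 0" for v
    using strongly_commuting_vanishes[OF strongly_commutes_diff_act[OF S, of p] _ u _ f]
      p order_nonzero_degree_le(1)[OF u] by simp
  then show ?thesis using that[of p] by (simp add: fun_eq_iff)
qed

end

section \<open>The characterization of strong commutation\<close>

theorem theorem4p1:
  fixes s :: "'a::field \<Rightarrow> 'b::ab_group_add \<Rightarrow> 'b" and Basis :: "'b set"
    and T S :: "'b \<Rightarrow> 'b"
  assumes "finite_dimensional_vector_space s Basis"
    and "T \<in> lin_ops s"
    and "S \<in> commutant s T"
  shows "strongly_commutes s S T \<longleftrightarrow> S \<in> generated_algebra s T"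
proof -
  have "Vector_Spaces.linear s s T" using assms(2) by (simp add: lin_ops_def)
  then have "operator s T"
    by (intro operator.intro operator_axioms.intro)
      (simp_all add: Vector_Spaces.linear_def)
  then interpret finite_dimensional_operator s Basis T
    by (rule finite_dimensional_operator.intro[OF assms(1)])
  show ?thesis
  proof
    assume "strongly_commutes s S T"
    then show "S \<in> generated_algebra s T"
      using strongly_commutes_imp_polynomial unfolding generated_algebra_eq by blast
  next
    assume "S \<in> generated_algebra s T"
    then obtain p where "S = act p" unfolding generated_algebra_eq by blast
    then show "strongly_commutes s S T"
      using assms(3) act_in_invariant_subspace unfolding strongly_commutes_def by blast
  qed
qed

end
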